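(* Let $r>3$, $f\in\mathcal{F}_\infty$, let $x^\star$ be a minimizer of $f$ and $f^\star=f(x^\star)$, let $x_0\in\mathbb{R}^n$, and let $X$ be the solution of $$\ddot X(t)+\frac{r}{t}\dot X(t)+\nabla f(X(t))=0\quad (t>0),\qquad X(0)=x_0,\ \dot X(0)=0 .$$ Then for every $t>0$ $$f(X(t))-f^\star\le\frac{(r-1)^2\|x_0-x^\star\|^2}{2t^2},$$ and $$\int_0^\infty t\,\bigl(f(X(t))-f^\star\bigr)\,\mathrm{d}t\le\frac{(r-1)^2\|x_0-x^\star\|^2}{2(r-3)} .$$
   Context: $\|\cdot\|$ is the Euclidean norm on $\mathbb{R}^n$. For $L>0$, $\mathcal{F}_L$ is the class of convex continuously differentiable functions $f:\mathbb{R}^n\to\mathbb{R}$ with $\|\nabla f(x)-\nabla f(y)\|\le L\|x-y\|$ for all $x,y\in\mathbb{R}^n$, and $\mathcal{F}_\infty=\bigcup_{L>0}\mathcal{F}_L$. The differential equation above has a unique solution in $C^2((0,\infty);\mathbb{R}^n)\cap C^1([0,\infty);\mathbb{R}^n)$ with the given initial conditions; $X$ denotes this solution. *)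

theory Defs
  imports "HOL-Analysis.Analysis"
begin

definition grad :: "(real ^ 'n \<Rightarrow> real) \<Rightarrow> real ^ 'n \<Rightarrow> real ^ 'n"
  where "grad f x = (THE D. GDERIV f x :> D)"

definition F_class :: "real \<Rightarrow> (real ^ 'n \<Rightarrow> real) set"
  where "F_class L = {f. convex_on UNIV f
    \<and> (\<forall>x. f differentiable at x) \<and> continuous_on UNIV (grad f)
    \<and> (\<forall>x y. norm (grad f x - grad f y) \<le> L * norm (x - y))}"

definition F_infinity :: "(real ^ 'n \<Rightarrow> real) set"
  where "F_infinity = (\<Union>L\<in>{0<..}. F_class L)"

(* V and A are the first and second derivatives of X. Only the restriction of X
   to [0,\<infinity>) matters; the derivative at 0 is one-sided. Continuity of
   V on [0,\<infinity>) and of A on (0,\<infinity>) expresses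
   X \<in> C^1([0,\<infinity>)) \<inter> C^2((0,\<infinity>)). *)
definition ode_solution ::
    "real \<Rightarrow> (real ^ 'n \<Rightarrow> real) \<Rightarrow> real ^ 'n \<Rightarrow> (real \<Rightarrow> real ^ 'n) \<Rightarrow> bool"
  where "ode_solution r f x0 X \<longleftrightarrow> (\<exists>V A.
      (\<forall>t\<ge>0. (X has_vector_derivative V t) (at t within {0..}))
    \<and> continuous_on {0..} V
    \<and> (\<forall>t>0. (V has_vector_derivative A t) (at t))
    \<and> continuous_on {0<..} A
    \<and> (\<forall>t>0. A t + (r / t) *\<^sub>R V t + grad f (X t) = 0)
    \<and> X 0 = x0 \<and> V 0 = 0)"

end

theory Submission
  imports Defs
begin

text \<open>With \<open>Y t = (r - 1) (X t - x\<^sup>\<star>) + t X' t\<close> the equation becomes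
  \<open>Y' = - t grad f (X t)\<close>.  Convexity then shows that the energy
  \<open>t\<^sup>2 (f (X t) - f\<^sup>\<star>) + |Y t|\<^sup>2 / 2\<close> has derivative at most
  \<open>- (r - 3) t (f (X t) - f\<^sup>\<star>)\<close>.  Both claims follow by integrating from \<open>0\<close>, where the energy
  equals \<open>(r - 1)\<^sup>2 |x\<^sub>0 - x\<^sup>\<star>|\<^sup>2 / 2\<close>.\<close>

text \<open>Since \<open>grad\<close> is a definite description, both existence and uniqueness are
  needed. Existence is the Riesz representation of the derivative, read off on the basis; uniqueness
  is inherited from the uniqueness of the derivative.\<close>

lemma GDERIV_grad:
  fixes f :: "real ^ 'n \<Rightarrow> real"
  assumes "f differentiable at x"
  shows "GDERIV f x :> grad f x"
proof -
  obtain f' where f': "(f has_derivative f') (at x)"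
    using assms by (auto simp: differentiable_def)
  interpret f': bounded_linear f'
    using f' by (rule has_derivative_bounded_linear)
  define D where "D = (\<Sum>b\<in>Basis. f' b *\<^sub>R b)"
  have "f' h = inner h D" for h
  proof -
    have "f' h = f' (\<Sum>b\<in>Basis. inner h b *\<^sub>R b)"
      by (simp only: euclidean_representation)
    also have "\<dots> = (\<Sum>b\<in>Basis. inner h b * f' b)"
      by (simp only: f'.sum f'.scaleR real_scaleR_def)
    also have "\<dots> = inner h D"
      by (simp add: D_def inner_sum_right mult.commute)
    finally show ?thesis .
  qed
  then have "f' = (\<lambda>h. inner h D)" ..
  with f' have D: "GDERIV f x :> D" by (simp add: gderiv_def)
  have "E = D" if "GDERIV f x :> E" for E
  proof -
    have "(\<lambda>h. inner h E) = (\<lambda>h. inner h D)"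
      using that D unfolding gderiv_def by (rule has_derivative_unique)
    then have "inner h E = inner h D" for h by (rule fun_cong)
    then show ?thesis using vector_eq_ldot[of E D] by blast
  qed
  with D have "grad f x = D" unfolding grad_def by blast
  with D show ?thesis by simp
qed

text \<open>Restricting \<open>f\<close> to the line through \<open>x\<close> and \<open>y\<close>
  reduces this to the one-dimensional tangent inequality, applied between the parameters 0 and
  1.\<close>

lemma convex_on_GDERIV_above_tangent:
  fixes f :: "'a::real_inner \<Rightarrow> real"
  assumes conv: "convex_on UNIV f" and D: "GDERIV f x :> D"
  shows "f x + inner (y - x) D \<le> f y"
proof -
  define \<phi> where "\<phi> s = f (x + s *\<^sub>R (y - x))" for s
  have "convex_on UNIV \<phi>"
  proof (rule convex_onI)
    fix t a b :: real assume t: "0 < t" "t < 1"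
    have "x + ((1 - t) *\<^sub>R a + t *\<^sub>R b) *\<^sub>R (y - x)
        = (1 - t) *\<^sub>R (x + a *\<^sub>R (y - x)) + t *\<^sub>R (x + b *\<^sub>R (y - x))"
      by (simp add: algebra_simps)
    then show "\<phi> ((1 - t) *\<^sub>R a + t *\<^sub>R b) \<le> (1 - t) * \<phi> a + t * \<phi> b"
      unfolding \<phi>_def using convex_onD[OF conv, of t] t by simp
  qed simp
  moreover have "(\<phi> has_real_derivative inner (y - x) D) (at 0)"
  proof -
    have "((\<lambda>s. x + s *\<^sub>R (y - x)) has_derivative (\<lambda>s. s *\<^sub>R (y - x))) (at 0)"
      by (auto intro!: derivative_eq_intros)
    moreover have "(f has_derivative (\<lambda>h. inner h D)) (at (x + 0 *\<^sub>R (y - x)))"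
      using D by (simp add: gderiv_def)
    ultimately have "(\<phi> has_derivative (\<lambda>s. inner (s *\<^sub>R (y - x)) D)) (at 0)"
      unfolding \<phi>_def by (rule has_derivative_compose)
    then show ?thesis
      by (rule has_derivative_imp_has_field_derivative) simp
  qed
  ultimately have "\<phi> 1 - \<phi> 0 \<ge> inner (y - x) D * (1 - 0)"
    by (intro convex_on_imp_above_tangent[where A = UNIV]) auto
  then show ?thesis by (simp add: \<phi>_def)
qed

text \<open>The derivative is two-sided because \<open>t\<close> is an interior point of
  \<open>{a..t + 1}\<close>; this is where \<open>a < t\<close> enters.\<close>

lemma integral_has_real_derivative_all:
  fixes k :: "real \<Rightarrow> real"
  assumes "continuous_on UNIV k" "a < t"
  shows "((\<lambda>u. integral {a..u} k) has_real_derivative k t) (at t)"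
proof -
  have "((\<lambda>u. integral {a..u} k) has_real_derivative k t) (at t within {a..t + 1})"
    using assms by (intro integral_has_real_derivative) (auto intro: continuous_on_subset)
  moreover have "at t within {a..t + 1} = at t"
    using assms by (intro at_within_interior) auto
  ultimately show ?thesis by simp
qed

text \<open>A nonnegative integrand makes \<open>G\<close> nondecreasing, so boundedness forces
  convergence to the supremum \<open>l\<close>. The fundamental theorem for nonnegative integrals
  then gives the value \<open>l - G a\<close>, whose finiteness is the integrability.\<close>

lemma set_integrable_atLeast_bounded_antiderivative:
  fixes k G :: "real \<Rightarrow> real"
  assumes k: "k \<in> borel_measurable borel"
    and G: "\<And>t. a \<le> t \<Longrightarrow> (G has_real_derivative k t) (at t)"
    and nonneg: "\<And>t. a \<le> t \<Longrightarrow> 0 \<le> k t"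
    and bound: "\<And>t. a \<le> t \<Longrightarrow> G t - G a \<le> B"
  shows "set_integrable lborel {a..} k" and "(LINT t:{a..}|lborel. k t) \<le> B"
proof -
  have mono: "G s \<le> G t" if "a \<le> s" "s \<le> t" for s t
  proof (rule DERIV_nonneg_imp_nondecreasing[OF that(2)])
    fix x assume "s \<le> x" "x \<le> t"
    with that show "\<exists>y. (G has_real_derivative y) (at x) \<and> 0 \<le> y"
      using G[of x] nonneg[of x] by auto
  qed
  define l where "l = (SUP t\<in>{a..}. G t)"
  have bdd: "bdd_above (G ` {a..})"
  proof (rule bdd_aboveI2)
    show "G t \<le> G a + B" if "t \<in> {a..}" for t using bound[of t] that by simp
  qed
  have "(G \<longlongrightarrow> l) at_top"
  proof (rule increasing_tendsto)
    show "\<forall>\<^sub>F t in at_top. G t \<le> l"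
      using eventually_ge_at_top[of a] by eventually_elim (auto simp: l_def intro!: cSUP_upper bdd)
    fix y assume "y < l"
    then obtain s where s: "s \<ge> a" "y < G s"
      unfolding l_def by (subst (asm) less_cSUP_iff[OF _ bdd]) auto
    show "\<forall>\<^sub>F t in at_top. y < G t"
      using eventually_ge_at_top[of s]
    proof eventually_elim
      case (elim t)
      then show ?case using s mono[of s t] by linarith
    qed
  qed
  then have nn: "(\<integral>\<^sup>+t. ennreal (k t) * indicator {a..} t \<partial>lborel) = ennreal (l - G a)"
    using k G nonneg by (intro nn_integral_FTC_atLeast) auto
  have "l \<le> G a + B"
    unfolding l_def
  proof (rule cSUP_least)
    show "G t \<le> G a + B" if "t \<in> {a..}" for t using bound[of t] that by simp
  qed simp
  moreover have "G a \<le> l"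
    unfolding l_def by (intro cSUP_upper bdd) auto
  moreover have "has_bochner_integral lborel (\<lambda>t. indicator {a..} t *\<^sub>R k t) (l - G a)"
  proof (rule has_bochner_integral_nn_integral)
    show "(\<integral>\<^sup>+t. ennreal (indicator {a..} t *\<^sub>R k t) \<partial>lborel) = ennreal (l - G a)"
      unfolding nn[symmetric] by (intro nn_integral_cong) (auto simp: indicator_def)
  qed (use k nonneg \<open>G a \<le> l\<close> in \<open>auto simp: indicator_def\<close>)
  ultimately show "set_integrable lborel {a..} k" "(LINT t:{a..}|lborel. k t) \<le> B"
    by (auto simp: set_integrable_def set_lebesgue_integral_def
        has_bochner_integral_iff)
qed

theorem theorem5:
  fixes r fstar :: real
    and f :: "real ^ 'n \<Rightarrow> real"
    and xstar x0 :: "real ^ 'n"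
    and X :: "real \<Rightarrow> real ^ 'n"
  assumes "r > 3"
    and "f \<in> F_infinity"
    and "\<forall>y. f xstar \<le> f y"
    and "fstar = f xstar"
    and "ode_solution r f x0 X"
  shows "(\<forall>t>0. f (X t) - fstar \<le> (r - 1)\<^sup>2 * (norm (x0 - xstar))\<^sup>2 / (2 * t\<^sup>2))
    \<and> set_integrable lborel {0..} (\<lambda>t. t * (f (X t) - fstar))
    \<and> (LINT t:{0..}|lborel. t * (f (X t) - fstar))
        \<le> (r - 1)\<^sup>2 * (norm (x0 - xstar))\<^sup>2 / (2 * (r - 3))"
proof -
  have conv: "convex_on UNIV f" and diff: "\<And>x. f differentiable at x"
    using assms(2) by (auto simp: F_infinity_def F_class_def)
  note grad = GDERIV_grad[OF diff]
  have f_cont: "continuous_on UNIV f"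
    using diff differentiable_imp_continuous_within
    by (auto simp: continuous_on_eq_continuous_within)
  obtain V A where dX: "\<And>t. t \<ge> 0 \<Longrightarrow> (X has_vector_derivative V t) (at t within {0..})"
    and V_cont: "continuous_on {0..} V"
    and dV: "\<And>t. t > 0 \<Longrightarrow> (V has_vector_derivative A t) (at t)"
    and ode: "\<And>t. t > 0 \<Longrightarrow> A t + (r / t) *\<^sub>R V t + grad f (X t) = 0"
    and init: "X 0 = x0" "V 0 = 0"
    using assms(5) unfolding ode_solution_def by blast
  have X_cont: "continuous_on {0..} X"
    by (rule continuous_on_vector_derivative[of _ _ V]) (use dX in auto)
  have dX': "(X has_vector_derivative V t) (at t)" if "t > 0" for t
    using dX[of t] that by (simp add: at_within_interior[of t "{0..}"])

  define h where "h t = f (X t) - fstar" for t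
  have h_nonneg: "0 \<le> h t" for t using assms(3,4) by (simp add: h_def)
  have h_cont: "continuous_on {0..} h"
    unfolding h_def by (intro continuous_intros continuous_on_compose2[OF f_cont X_cont]) auto
  have dh: "(h has_real_derivative inner (V t) (grad f (X t))) (at t)" if "t > 0" for t
  proof -
    have "((\<lambda>t. f (X t)) has_derivative (\<lambda>s. inner (s *\<^sub>R V t) (grad f (X t)))) (at t)"
      using dX'[OF that] grad[of "X t"] unfolding gderiv_def has_vector_derivative_def
      by (rule has_derivative_compose)
    then have "((\<lambda>t. f (X t)) has_real_derivative inner (V t) (grad f (X t))) (at t)"
      by (rule has_derivative_imp_has_field_derivative) simp
    then show ?thesis unfolding h_def by (auto intro!: derivative_eq_intros)
  qed

  define Y where "Y t = (r - 1) *\<^sub>R (X t - xstar) + t *\<^sub>R V t" for t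
  have Y_cont: "continuous_on {0..} Y"
    unfolding Y_def by (intro continuous_intros X_cont V_cont)
  have dY: "(Y has_vector_derivative (- t) *\<^sub>R grad f (X t)) (at t)" if t: "t > 0" for t
  proof -
    have "(Y has_vector_derivative (r - 1) *\<^sub>R V t + (t *\<^sub>R A t + V t)) (at t)"
      unfolding Y_def using dX'[OF t] dV[OF t]
      by (auto intro!: derivative_eq_intros simp: has_vector_derivative_def algebra_simps)
    \<comment> \<open>The weight \<open>r - 1\<close> in \<open>Y\<close> is chosen for this: with
      the extra \<open>V t\<close> from the product rule, the velocity terms add up to
      \<open>r\<close> times \<open>V t\<close>, which is the friction term multiplied by
      \<open>t\<close>.\<close>
    moreover have "(r - 1) *\<^sub>R V t + (t *\<^sub>R A t + V t)
        = t *\<^sub>R (A t + (r / t) *\<^sub>R V t + grad f (X t)) + (- t) *\<^sub>R grad f (X t)"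
      using t by (simp add: algebra_simps)
    then have "(r - 1) *\<^sub>R V t + (t *\<^sub>R A t + V t) = (- t) *\<^sub>R grad f (X t)"
      by (simp only: ode[OF t] scaleR_zero_right add_0_left)
    ultimately show ?thesis by simp
  qed

  define W where "W t = t\<^sup>2 * h t + inner (Y t) (Y t) / 2" for t
  define W' where "W' t = 2 * t * h t - (r - 1) * t * inner (X t - xstar) (grad f (X t))" for t
  have dW: "(W has_real_derivative W' t) (at t)" if t: "t > 0" for t
  proof -
    let ?g = "grad f (X t)"
    have "((\<lambda>t. inner (Y t) (Y t)) has_real_derivative - 2 * t * inner (Y t) ?g) (at t)"
      using has_derivative_inner[OF dY[OF t, unfolded has_vector_derivative_def]
          dY[OF t, unfolded has_vector_derivative_def]]
      by (rule has_derivative_imp_has_field_derivative) (simp add: inner_commute)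
    then have "(W has_real_derivative
        2 * t * h t + t\<^sup>2 * inner (V t) ?g + - 2 * t * inner (Y t) ?g / 2) (at t)"
      unfolding W_def using dh[OF t] by (auto intro!: derivative_eq_intros)
    \<comment> \<open>The velocity part of \<open>Y t\<close> contributes minus
      \<open>t\<^sup>2 * inner (V t) ?g\<close>, which cancels the term coming from the derivative
      of \<open>h\<close>.\<close>
    moreover have "2 * t * h t + t\<^sup>2 * inner (V t) ?g + - 2 * t * inner (Y t) ?g / 2 = W' t"
      by (simp add: Y_def W'_def inner_add_left inner_diff_left power2_eq_square field_simps)
    ultimately show ?thesis by simp
  qed
  have W'_le: "W' t + (r - 3) * (t * h t) \<le> 0" if t: "t > 0" for t
  proof -
    \<comment> \<open>This is the tangent inequality at \<open>X t\<close>, evaluated at the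
      minimizer.\<close>
    have "h t \<le> inner (X t - xstar) (grad f (X t))"
      using convex_on_GDERIV_above_tangent[OF conv grad, of "X t" xstar] assms(4)
      by (simp add: h_def inner_diff_left)
    then have "((r - 1) * t) * h t \<le> ((r - 1) * t) * inner (X t - xstar) (grad f (X t))"
      using t assms(1) by (intro mult_left_mono) auto
    then show ?thesis by (simp add: W'_def algebra_simps)
  qed

  \<comment> \<open>\<open>X\<close> is unconstrained on negative times, so the integrand is extended by \<open>0\<close> there to make it
    continuous on the whole line.\<close>
  define k where "k t = max 0 t * h (max 0 t)" for t
  have k_cont: "continuous_on UNIV k"
    unfolding k_def by (intro continuous_intros continuous_on_compose2[OF h_cont]) auto
  have k_eq: "k t = t * h t" if "t \<ge> 0" for t using that by (simp add: k_def)
  \<comment> \<open>Starting at -1 instead of 0 puts 0 in the interior, so that \<open>G\<close> has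
    a two-sided derivative there too. Only differences of \<open>G\<close> matter below.\<close>
  define G where "G t = integral {-1..t} k" for t
  have dG: "(G has_real_derivative k t) (at t)" if "0 \<le> t" for t
    unfolding G_def using k_cont that by (intro integral_has_real_derivative_all) auto
  have G_cont: "continuous_on {0..} G"
    by (rule DERIV_continuous_on[where D = k]) (auto intro: DERIV_subset[OF dG])

  have energy: "W t + (r - 3) * (G t - G 0) \<le> W 0" if "t \<ge> 0" for t
  proof -
    have "W t + (r - 3) * G t \<le> W 0 + (r - 3) * G 0"
    \<comment> \<open>The equation is singular at 0, so the derivative is controlled only on the
      open interval; continuity of the energy carries the inequality to the endpoint 0.\<close>
    proof (rule DERIV_nonpos_imp_decreasing_open[OF that])
      fix s :: real assume s: "0 < s" "s < t"
      show "\<exists>y. ((\<lambda>s. W s + (r - 3) * G s) has_real_derivative y) (at s) \<and> y \<le> 0"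
      proof (intro exI conjI)
        show "((\<lambda>s. W s + (r - 3) * G s) has_real_derivative W' s + (r - 3) * (s * h s)) (at s)"
          using dW[of s] dG[of s] k_eq[of s] s by (auto intro!: derivative_eq_intros)
      qed (use W'_le s in auto)
    next
      have "continuous_on {0..} (\<lambda>s. W s + (r - 3) * G s)"
        unfolding W_def by (intro continuous_intros h_cont Y_cont G_cont) auto
      then show "continuous_on {0..t} (\<lambda>s. W s + (r - 3) * G s)"
        by (rule continuous_on_subset) auto
    qed
    then show ?thesis by (simp add: algebra_simps)
  qed
  have W0: "W 0 = (r - 1)\<^sup>2 * (norm (x0 - xstar))\<^sup>2 / 2"
    by (simp add: W_def Y_def init dot_square_norm power_mult_distrib)
  have G_mono: "G 0 \<le> G t" if "0 \<le> t" for t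
  proof (rule DERIV_nonneg_imp_nondecreasing[OF that])
    fix s :: real assume "0 \<le> s" "s \<le> t"
    then show "\<exists>y. (G has_real_derivative y) (at s) \<and> 0 \<le> y"
      using dG[of s] k_eq[of s] h_nonneg[of s] by auto
  qed
  have rate: "h t \<le> (r - 1)\<^sup>2 * (norm (x0 - xstar))\<^sup>2 / (2 * t\<^sup>2)" if t: "t > 0" for t
  proof -
    \<comment> \<open>For the pointwise rate, the accumulated integral and the square of
      \<open>Y\<close> are both discarded from the energy inequality.\<close>
    have "0 \<le> (r - 3) * (G t - G 0)" using G_mono[of t] t assms(1) by simp
    moreover have "t\<^sup>2 * h t \<le> W t" by (simp add: W_def)
    ultimately have "t\<^sup>2 * h t \<le> (r - 1)\<^sup>2 * (norm (x0 - xstar))\<^sup>2 / 2"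
      using energy[of t] t W0 by linarith
    then show ?thesis using t by (simp add: field_simps)
  qed
  have G_bound: "G t - G 0 \<le> (r - 1)\<^sup>2 * (norm (x0 - xstar))\<^sup>2 / (2 * (r - 3))" if "0 \<le> t" for t
  proof -
    \<comment> \<open>For the integral bound, \<open>W t\<close> is discarded instead, and the
      strict inequality \<open>r > 3\<close> permits division by \<open>r - 3\<close>.\<close>
    have "0 \<le> W t" using h_nonneg by (simp add: W_def)
    then have "(r - 3) * (G t - G 0) \<le> (r - 1)\<^sup>2 * (norm (x0 - xstar))\<^sup>2 / 2"
      using energy[OF that] W0 by linarith
    then show ?thesis using assms(1) by (simp add: field_simps)
  qed
  have k_nonneg: "0 \<le> k t" for t by (simp add: k_def h_nonneg)
  note k_integral = set_integrable_atLeast_bounded_antiderivative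
    [OF borel_measurable_continuous_onI[OF k_cont] dG k_nonneg G_bound]
  \<comment> \<open>The extension \<open>k\<close> agrees with the original integrand on the domain
    of integration, so both conclusions transfer.\<close>
  have "set_integrable lborel {0..} k \<longleftrightarrow> set_integrable lborel {0..} (\<lambda>t. t * h t)"
    by (rule set_integrable_cong) (auto simp: k_eq)
  moreover have "(LINT t:{0..}|lborel. k t) = (LINT t:{0..}|lborel. t * h t)"
    by (rule set_lebesgue_integral_cong) (auto simp: k_eq)
  ultimately show ?thesis using k_integral rate unfolding h_def by simp
qed

end
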